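(* Suppose the reward weight equals the teacher weight, $\mathbf w_R=\mathbf w_T=\mathbf w$, and let $\delta=\delta(k,n)$ be the leading-order generalization error (for $T\to0$ followed by $k\to\infty$) given in the context. Consider the regime $$\frac{\gamma^2}{d}\mathrm{Tr}(\mathbf B_R\boldsymbol{\Sigma})\ll\sigma^2,\qquad R\ll\sigma^2 .$$ In this regime $$\frac{\partial\log\delta}{\partial\log k}=-2,\qquad \frac{\partial\log\delta}{\partial\log n}=-\frac{\alpha\,\partial_\alpha\big(\mathbf u^\top\boldsymbol{\Sigma}\mathbf u\big)}{\sigma^2d-2\,\mathbf u^\top\boldsymbol{\Sigma}\mathbf u},$$ and hence $$\left|\frac{\partial\log\delta}{\partial\log k}\right|\gg\left|\frac{\partial\log\delta}{\partial\log n}\right| ,$$ i.e. for every $\varepsilon>0$ there is $\eta>0$ such that, for all parameters as in the context with $\frac{\gamma^2}{d\,\sigma^2}\mathrm{Tr}(\mathbf B_R\boldsymbol{\Sigma})<\eta$ and $R/\sigma^2<\eta$, the two derivative formulas hold and $\left|\frac{\partial\log\delta}{\partial\log n}\right|\le\varepsilon\left|\frac{\partial\log\delta}{\partial\log k}\right|$.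
   Context: Setting. $d\ge1$ is an integer, $n>d$ is the number of training samples, treated as a real variable, $\alpha=d/n<1$; $\sigma,\gamma>0$; $\boldsymbol{\Sigma}$ is a symmetric positive semidefinite $d\times d$ matrix; $\mathbf w\in\mathbb R^d$ with $\|\mathbf w\|^2=d$; $k>0$ is the number of inference-time samples, treated as a real variable. $R=R(\alpha)>0$ is the solution of $R\big(1-\alpha\, m_{\boldsymbol{\Sigma}}(R)\big)=\frac{\sigma^2}{\gamma^2}\alpha$, where $m_{\boldsymbol{\Sigma}}(R)=\frac1d\mathrm{Tr}\big[\boldsymbol{\Sigma}(\boldsymbol{\Sigma}+R\mathbf I)^{-1}\big]$. Set $\mathbf B_R=R(\boldsymbol{\Sigma}+R\mathbf I)^{-1}$ and $\mathbf u=\mathbf B_R\mathbf w$ (so $\mathbf u$ depends on $\alpha$ through $R$). Leading-order generalization error of teacher-rewarded best-of-$k$ sampling in this regime: $$\delta(k,n)=\frac{\pi\sigma^2}{k^2}\,\frac{1}{\sqrt{1-\frac{2}{\sigma^2d}\,\mathbf u^\top\boldsymbol{\Sigma}\mathbf u}} .$$ Partial derivatives in $\log k$ and $\log n$ are taken with $d,\sigma,\gamma,\boldsymbol{\Sigma},\mathbf w$ fixed (so $n$ enters only through $\alpha=d/n$); $\partial_\alpha$ denotes the derivative in $\alpha$ with the same quantities fixed. *)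

theory Defs
  imports "HOL-Analysis.Derivative" "Jordan_Normal_Form.Gauss_Jordan_Elimination"
begin

unbundle no inner_syntax

text \<open>The dimension \<open>d\<close> ranges over the parameters over which the threshold is uniform, so it
  has to be a term: matrices and vectors have explicit carriers \<open>carrier_mat d d\<close>, \<open>carrier_vec d\<close>.\<close>

definition psd_mat :: "nat \<Rightarrow> real mat \<Rightarrow> bool" where
  "psd_mat d S \<longleftrightarrow> S \<in> carrier_mat d d \<and> transpose_mat S = S \<and>
     (\<forall>v \<in> carrier_vec d. 0 \<le> v \<bullet> (S *\<^sub>v v))"

definition mat_tr :: "real mat \<Rightarrow> real" where
  "mat_tr A = (\<Sum>i<dim_row A. A $$ (i, i))"

text \<open>\<open>(S + R I)\<^sup>-\<^sup>1\<close>; the inverse exists whenever \<open>S\<close> is positive semidefinite and \<open>R > 0\<close>.\<close>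

definition resolvent :: "nat \<Rightarrow> real mat \<Rightarrow> real \<Rightarrow> real mat" where
  "resolvent d S R = the (mat_inverse (S + R \<cdot>\<^sub>m 1\<^sub>m d))"

definition m_S :: "nat \<Rightarrow> real mat \<Rightarrow> real \<Rightarrow> real" where
  "m_S d S R = mat_tr (S * resolvent d S R) / real d"

text \<open>For \<open>0 < \<alpha> < 1\<close> and \<open>S\<close> positive semidefinite the positive solution is unique, since
  \<open>R * (1 - \<alpha> * m_S d S R)\<close> tends to \<open>0\<close> as \<open>R\<close> tends to \<open>0\<close> and has derivative at least \<open>1 - \<alpha>\<close>.\<close>

definition R_sol :: "nat \<Rightarrow> real \<Rightarrow> real \<Rightarrow> real mat \<Rightarrow> real \<Rightarrow> real" where
  "R_sol d \<sigma> \<gamma> S \<alpha> =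
     (THE R. R > 0 \<and> R * (1 - \<alpha> * m_S d S R) = \<sigma>\<^sup>2 / \<gamma>\<^sup>2 * \<alpha>)"

definition B_mat :: "nat \<Rightarrow> real \<Rightarrow> real \<Rightarrow> real mat \<Rightarrow> real \<Rightarrow> real mat" where
  "B_mat d \<sigma> \<gamma> S \<alpha> = R_sol d \<sigma> \<gamma> S \<alpha> \<cdot>\<^sub>m resolvent d S (R_sol d \<sigma> \<gamma> S \<alpha>)"

definition u_vec :: "nat \<Rightarrow> real \<Rightarrow> real \<Rightarrow> real mat \<Rightarrow> real vec \<Rightarrow> real \<Rightarrow> real vec" where
  "u_vec d \<sigma> \<gamma> S w \<alpha> = B_mat d \<sigma> \<gamma> S \<alpha> *\<^sub>v w"

definition uSu :: "nat \<Rightarrow> real \<Rightarrow> real \<Rightarrow> real mat \<Rightarrow> real vec \<Rightarrow> real \<Rightarrow> real" where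
  "uSu d \<sigma> \<gamma> S w \<alpha> = u_vec d \<sigma> \<gamma> S w \<alpha> \<bullet> (S *\<^sub>v u_vec d \<sigma> \<gamma> S w \<alpha>)"

definition gen_error ::
  "nat \<Rightarrow> real \<Rightarrow> real \<Rightarrow> real mat \<Rightarrow> real vec \<Rightarrow> real \<Rightarrow> real \<Rightarrow> real" where
  "gen_error d \<sigma> \<gamma> S w k n =
     pi * \<sigma>\<^sup>2 / k\<^sup>2 * (1 / sqrt (1 - 2 / (\<sigma>\<^sup>2 * real d) * uSu d \<sigma> \<gamma> S w (real d / n)))"

text \<open>\<open>d log f / d log x\<close> at \<open>x > 0\<close>, i.e. the derivative of \<open>t \<mapsto> log f(e\<^sup>t)\<close> at \<open>t = log x\<close>.\<close>

definition has_dlog_dlog :: "(real \<Rightarrow> real) \<Rightarrow> real \<Rightarrow> real \<Rightarrow> bool" where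
  "has_dlog_dlog f D x \<longleftrightarrow> ((\<lambda>t. ln (f (exp t))) has_real_derivative D) (at (ln x))"

definition dlog_dlog :: "(real \<Rightarrow> real) \<Rightarrow> real \<Rightarrow> real" where
  "dlog_dlog f x = deriv (\<lambda>t. ln (f (exp t))) (ln x)"

end

(* In an orthonormal eigenbasis of S every quantity is a sum over the eigenvalues lam i. With
   c = sigma^2 / gamma^2 and g R = R * m_S R, the equation for R reads alpha = R / (c + g R): alpha is
   an explicit strictly increasing function of R, so R(alpha) is differentiable with
   alpha * R' = R * (c + g R) / (c + g R - R * g' R) <= R * (c + g R) / c, because R * g' R <= g R.
   The smallness of the trace is g R < eta * c, whence alpha * R' <= R * (1 + eta). The quadratic form
   u^T S u is at most R * d / 4 with R-derivative in [0, 2 * d]. Hence |d log delta / d log n| is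
   at most of order R / sigma^2 < eta, whereas |d log delta / d log k| = 2. *)

theory Submission
  imports Defs "Jordan_Normal_Form.Spectral_Radius"
begin

unbundle no vec_syntax

section \<open>Spectral theorem for real symmetric matrices, by Householder deflation\<close>

text \<open>Over the complex numbers \<open>S\<close> has an eigenvector \<open>z\<close>, since
  \<open>n > 0\<close>. Its real and imaginary parts \<open>x\<close>, \<open>y\<close> obey a
  coupled real system; symmetry of \<open>S\<close> forces \<open>Im \<mu> = 0\<close>, which
  decouples it. At least one of \<open>x\<close>, \<open>y\<close> is nonzero, and that one is
  normalised.\<close>

lemma real_symmetric_eigenvector_exists:
  fixes S :: "real mat"
  assumes S: "S \<in> carrier_mat n n" "transpose_mat S = S" and n: "n > 0"
  obtains v a where "v \<in> carrier_vec n" "v \<bullet> v = 1" "S *\<^sub>v v = a \<cdot>\<^sub>v v"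
proof -
  note result = that
  define C where "C = map_mat complex_of_real S"
  have C: "C \<in> carrier_mat n n" using S by (simp add: C_def)
  obtain \<mu> z where z: "z \<in> carrier_vec n" "z \<noteq> 0\<^sub>v n" "C *\<^sub>v z = \<mu> \<cdot>\<^sub>v z"
    using spectrum_non_empty[OF C n] C
    unfolding spectrum_def eigenvalue_def eigenvector_def by auto
  define x where "x = map_vec Re z"
  define y where "y = map_vec Im z"
  have x: "x \<in> carrier_vec n" and y: "y \<in> carrier_vec n"
    using z(1) by (auto simp: x_def y_def)
  have Cz: "(C *\<^sub>v z) $ i = (\<Sum>j = 0..<n. of_real (S $$ (i,j)) * z $ j)" if "i < n" for i
    using that S z(1) by (simp add: C_def scalar_prod_def)
  have Sx: "S *\<^sub>v x = Re \<mu> \<cdot>\<^sub>v x + (- Im \<mu>) \<cdot>\<^sub>v y"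
  proof (rule eq_vecI)
    fix i assume "i < dim_vec (Re \<mu> \<cdot>\<^sub>v x + (- Im \<mu>) \<cdot>\<^sub>v y)"
    then have i: "i < n" using y by simp
    have "(S *\<^sub>v x) $ i = Re ((C *\<^sub>v z) $ i)"
      using i S z(1) unfolding Cz[OF i] by (simp add: scalar_prod_def x_def)
    then show "(S *\<^sub>v x) $ i = (Re \<mu> \<cdot>\<^sub>v x + (- Im \<mu>) \<cdot>\<^sub>v y) $ i"
      unfolding z(3) using i z(1) by (simp add: x_def y_def)
  qed (use S y in simp)
  have Sy: "S *\<^sub>v y = Im \<mu> \<cdot>\<^sub>v x + Re \<mu> \<cdot>\<^sub>v y"
  proof (rule eq_vecI)
    fix i assume "i < dim_vec (Im \<mu> \<cdot>\<^sub>v x + Re \<mu> \<cdot>\<^sub>v y)"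
    then have i: "i < n" using y by simp
    have "(S *\<^sub>v y) $ i = Im ((C *\<^sub>v z) $ i)"
      using i S z(1) unfolding Cz[OF i] by (simp add: scalar_prod_def y_def)
    then show "(S *\<^sub>v y) $ i = (Im \<mu> \<cdot>\<^sub>v x + Re \<mu> \<cdot>\<^sub>v y) $ i"
      unfolding z(3) using i z(1) by (simp add: x_def y_def)
  qed (use S y in simp)
  have pos: "x \<bullet> x + y \<bullet> y > 0"
  proof -
    obtain i where i: "i < n" "z $ i \<noteq> 0"
      using z(1,2) by (metis carrier_vecD eq_vecI index_zero_vec)
    have "0 < (Re (z $ i))\<^sup>2 + (Im (z $ i))\<^sup>2"
      using i(2) by (simp add: complex_neq_0)
    also have "\<dots> \<le> (\<Sum>i = 0..<n. (Re (z $ i))\<^sup>2 + (Im (z $ i))\<^sup>2)"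
      using i(1) by (intro member_le_sum) auto
    also have "\<dots> = x \<bullet> x + y \<bullet> y"
      using z(1) by (simp add: scalar_prod_def x_def y_def power2_eq_square sum.distrib)
    finally show ?thesis .
  qed
  \<comment> \<open>Symmetry of \<open>S\<close> forces the eigenvalue to be real.\<close>
  have "y \<bullet> (S *\<^sub>v x) = x \<bullet> (S *\<^sub>v y)"
    using transpose_vec_mult_scalar[OF S(1) x y] S x y
    by (metis comm_scalar_prod mult_mat_vec_carrier)
  then have "Im \<mu> * (x \<bullet> x + y \<bullet> y) = 0"
    unfolding Sx Sy using x y
    by (simp add: scalar_prod_add_distrib[of _ n] comm_scalar_prod[OF x y] algebra_simps)
  then have "Im \<mu> = 0" using pos by simp
  then have ev: "S *\<^sub>v x = Re \<mu> \<cdot>\<^sub>v x" "S *\<^sub>v y = Re \<mu> \<cdot>\<^sub>v y"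
    using Sx Sy x y by auto
  have nonneg: "x \<bullet> x \<ge> 0" "y \<bullet> y \<ge> 0"
    by (auto simp: scalar_prod_def intro!: sum_nonneg)
  have norm: thesis if v: "v \<in> carrier_vec n" "v \<bullet> v > 0" "S *\<^sub>v v = Re \<mu> \<cdot>\<^sub>v v" for v
  proof (rule result)
    show "(1 / sqrt (v \<bullet> v)) \<cdot>\<^sub>v v \<in> carrier_vec n" using v(1) by simp
    show "((1 / sqrt (v \<bullet> v)) \<cdot>\<^sub>v v) \<bullet> ((1 / sqrt (v \<bullet> v)) \<cdot>\<^sub>v v) = 1"
      using v(2) by (simp add: field_simps)
    show "S *\<^sub>v ((1 / sqrt (v \<bullet> v)) \<cdot>\<^sub>v v) = Re \<mu> \<cdot>\<^sub>v ((1 / sqrt (v \<bullet> v)) \<cdot>\<^sub>v v)"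
      using v S by (simp add: mult_mat_vec[of _ n n] smult_smult_assoc mult.commute)
  qed
  show thesis
    using norm[OF x _ ev(1)] norm[OF y _ ev(2)] pos nonneg by linarith
qed

text \<open>For \<open>u = 0\<close> the convention \<open>2 / 0 = 0\<close> makes this the identity.\<close>

definition reflection :: "nat \<Rightarrow> real vec \<Rightarrow> real mat" where
  "reflection n u = mat n n (\<lambda>(i, j). (if i = j then 1 else 0) - 2 / (u \<bullet> u) * u $ i * u $ j)"

lemma reflection_carrier [simp]: "reflection n u \<in> carrier_mat n n"
  by (simp add: reflection_def)

lemma transpose_reflection [simp]: "transpose_mat (reflection n u) = reflection n u"
  by (rule eq_matI) (auto simp: reflection_def)

lemma reflection_mult_vec:
  assumes "u \<in> carrier_vec n" "x \<in> carrier_vec n"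
  shows "reflection n u *\<^sub>v x = x + (- (2 / (u \<bullet> u) * (u \<bullet> x))) \<cdot>\<^sub>v u"
proof (rule eq_vecI)
  fix i assume "i < dim_vec (x + (- (2 / (u \<bullet> u) * (u \<bullet> x))) \<cdot>\<^sub>v u)"
  then have i: "i < n" using assms by simp
  have "(reflection n u *\<^sub>v x) $ i
      = (\<Sum>j = 0..<n. ((if i = j then 1 else 0) - 2 / (u \<bullet> u) * u $ i * u $ j) * x $ j)"
    using i assms(2) by (simp add: reflection_def scalar_prod_def)
  also have "\<dots> = (\<Sum>j = 0..<n. if i = j then x $ j else 0)
      - 2 / (u \<bullet> u) * u $ i * (\<Sum>j = 0..<n. u $ j * x $ j)"
    unfolding sum_distrib_left sum_subtractf[symmetric]
    by (rule sum.cong) (auto simp: algebra_simps)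
  also have "\<dots> = x $ i - 2 / (u \<bullet> u) * u $ i * (u \<bullet> x)"
    using i assms(2) by (simp add: scalar_prod_def)
  finally show "(reflection n u *\<^sub>v x) $ i = (x + (- (2 / (u \<bullet> u) * (u \<bullet> x))) \<cdot>\<^sub>v u) $ i"
    using i assms by (simp add: algebra_simps)
qed (use assms in \<open>simp add: reflection_def\<close>)

text \<open>The component along \<open>u\<close> changes sign, so a second application restores it.
  The check runs column by column, on unit vectors.\<close>

lemma reflection_involution:
  assumes u: "u \<in> carrier_vec n"
  shows "reflection n u * reflection n u = 1\<^sub>m n"
proof (rule eq_matI)
  fix i j assume "i < dim_row (1\<^sub>m n :: real mat)" "j < dim_col (1\<^sub>m n :: real mat)"
  then have ij: "i < n" "j < n" by auto
  let ?H = "reflection n u"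
  define x where "x = ?H *\<^sub>v unit_vec n j"
  have e: "unit_vec n j \<in> carrier_vec n" by simp
  have *: "?H *\<^sub>v x = unit_vec n j"
  proof (cases "u \<bullet> u = 0")
    case True
    then show ?thesis using u e unfolding x_def
      by (auto simp: reflection_mult_vec intro!: eq_vecI)
  next
    case False
    define s where "s = u \<bullet> unit_vec n j"
    have x': "x = unit_vec n j + (- (2 / (u \<bullet> u) * s)) \<cdot>\<^sub>v u"
      unfolding x_def s_def by (rule reflection_mult_vec[OF u e])
    have xc: "x \<in> carrier_vec n" unfolding x' using u by simp
    have "u \<bullet> x = s - 2 / (u \<bullet> u) * s * (u \<bullet> u)"
      unfolding x' s_def using u e by (subst scalar_prod_add_distrib[of _ n]) auto
    then have ux: "u \<bullet> x = - s" using False by simp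
    show ?thesis unfolding reflection_mult_vec[OF u xc] ux
      unfolding x' using u by (intro eq_vecI) auto
  qed
  have "(?H * ?H) $$ (i, j) = (?H *\<^sub>v col ?H j) $ i"
    using ij by (simp add: reflection_def)
  also have "col ?H j = x" unfolding x_def using ij
    by (intro eq_vecI) (auto simp: reflection_def)
  finally show "(?H * ?H) $$ (i, j) = 1\<^sub>m n $$ (i, j)"
    unfolding * using ij by simp
qed (auto simp: reflection_def)

text \<open>Reflecting along the difference of two vectors of equal length exchanges them. If the
  vectors coincide, the difference vanishes and the reflection is the identity.\<close>

lemma unit_vector_reflection:
  assumes v: "v \<in> carrier_vec n" "v \<bullet> v = 1" and n: "n > 0"
  obtains u where "u \<in> carrier_vec n" "reflection n u *\<^sub>v v = unit_vec n 0"
    "reflection n u *\<^sub>v unit_vec n 0 = v"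
proof
  define e :: "real vec" where "e = unit_vec n 0"
  define u where "u = e - v"
  have e: "e \<in> carrier_vec n" "e \<bullet> e = 1" "e \<bullet> v = v $ 0" "v \<bullet> e = v $ 0"
    using n v by (auto simp: e_def)
  show u: "u \<in> carrier_vec n" using v e by (simp add: u_def)
  have uv: "u \<bullet> v = v $ 0 - 1"
    unfolding u_def using v e by (simp add: minus_scalar_prod_distrib[of _ n])
  have ue: "u \<bullet> e = 1 - v $ 0"
    unfolding u_def using v e by (simp add: minus_scalar_prod_distrib[of _ n])
  have uu: "u \<bullet> u = 2 * (1 - v $ 0)"
    using uv ue scalar_prod_minus_distrib[OF u e(1) v(1)] by (simp add: u_def)
  have "reflection n u *\<^sub>v v = e \<and> reflection n u *\<^sub>v e = v"
  proof (cases "u \<bullet> u = 0")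
    case True
    then have "(\<Sum>i = 0..<n. (u $ i)\<^sup>2) = 0"
      using u by (simp add: scalar_prod_def power2_eq_square)
    then have "\<forall>i<n. u $ i = 0" by (subst (asm) sum_nonneg_eq_0_iff) auto
    then have "e = v" using e(1) v(1) by (intro eq_vecI) (auto simp: u_def)
    moreover have "reflection n u *\<^sub>v v = v"
      using True u v(1) by (auto simp: reflection_mult_vec intro!: eq_vecI)
    ultimately show ?thesis by simp
  next
    case False
    then have c: "2 / (u \<bullet> u) * (u \<bullet> v) = -1" "2 / (u \<bullet> u) * (u \<bullet> e) = 1"
      unfolding uv ue uu by (auto simp: field_simps)
    show ?thesis
      unfolding reflection_mult_vec[OF u v(1)] reflection_mult_vec[OF u e(1)] c
      using e(1) v(1) by (auto simp: u_def intro!: eq_vecI)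
  qed
  then show "reflection n u *\<^sub>v v = unit_vec n 0" "reflection n u *\<^sub>v unit_vec n 0 = v"
    by (auto simp: e_def)
qed

text \<open>Induction on the dimension: one eigenvector is split off by a conjugation, the remaining
  block is again symmetric, and its eigenbasis, extended by the first basis vector, is carried back
  by the same conjugation.\<close>

theorem real_spectral_theorem:
  fixes S :: "real mat"
  assumes "S \<in> carrier_mat n n" "transpose_mat S = S"
  shows "\<exists>U f. U \<in> carrier_mat n n \<and> transpose_mat U * U = 1\<^sub>m n \<and>
    S = U * mat_diag n f * transpose_mat U"
  using assms
proof (induction n arbitrary: S)
  case 0
  then show ?case by (intro exI[of _ "1\<^sub>m 0"] exI) (auto intro!: eq_matI)
next
  case (Suc m)
  let ?n = "Suc m"
  note S = Suc.prems
  obtain v a where v: "v \<in> carrier_vec ?n" "v \<bullet> v = 1" "S *\<^sub>v v = a \<cdot>\<^sub>v v"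
    using real_symmetric_eigenvector_exists[OF S] by blast
  obtain u where u: "u \<in> carrier_vec ?n" "reflection ?n u *\<^sub>v v = unit_vec ?n 0"
    "reflection ?n u *\<^sub>v unit_vec ?n 0 = v"
    using unit_vector_reflection[OF v(1,2)] by blast
  \<comment> \<open>A Householder reflection moves the eigenvector to the first basis vector and splits off \<open>a\<close>.\<close>
  define H where "H = reflection ?n u"
  have H: "H \<in> carrier_mat ?n ?n" "H * H = 1\<^sub>m ?n" "transpose_mat H = H"
    "H *\<^sub>v v = unit_vec ?n 0" "H *\<^sub>v unit_vec ?n 0 = v"
    using u reflection_involution[OF u(1)] by (auto simp: H_def)
  define M where "M = H * S * H"
  have M: "M \<in> carrier_mat ?n ?n" using H S by (simp add: M_def)
  have MT: "transpose_mat M = M"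
    using H S by (simp add: M_def transpose_mult[of _ ?n ?n _ ?n] assoc_mult_mat[of _ ?n ?n _ ?n _ ?n])
  have Me: "M *\<^sub>v unit_vec ?n 0 = a \<cdot>\<^sub>v unit_vec ?n 0"
    using H S v by (simp add: M_def assoc_mult_mat_vec[of _ ?n ?n _ ?n] mult_mat_vec[of _ ?n ?n])
  have M0: "M $$ (i, 0) = (if i = 0 then a else 0)" if "i < ?n" for i
  proof -
    have "M $$ (i, 0) = (M *\<^sub>v unit_vec ?n 0) $ i" using that M by simp
    then show ?thesis unfolding Me using that by simp
  qed
  \<comment> \<open>Symmetry of \<open>M\<close> carries the zeros of the first column over to the
    first row, so \<open>M\<close> is block diagonal.\<close>
  have M0': "M $$ (0, i) = (if i = 0 then a else 0)" if "i < ?n" for i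
    using M0[OF that] MT M that by (metis carrier_matD index_transpose_mat(1) zero_less_Suc)
  define T where "T = mat m m (\<lambda>(i, j). M $$ (Suc i, Suc j))"
  have T: "T \<in> carrier_mat m m" by (simp add: T_def)
  have "transpose_mat T = T"
  proof (rule eq_matI)
    fix i j assume "i < dim_row T" "j < dim_col T"
    then have ij: "i < m" "j < m" by (auto simp: T_def)
    then have "M $$ (Suc j, Suc i) = M $$ (Suc i, Suc j)"
      using MT M by (metis Suc_less_eq carrier_matD index_transpose_mat(1))
    then show "transpose_mat T $$ (i, j) = T $$ (i, j)" using ij by (simp add: T_def)
  qed (auto simp: T_def)
  from Suc.IH[OF T this] obtain V f where V: "V \<in> carrier_mat m m"
    "transpose_mat V * V = 1\<^sub>m m" "T = V * mat_diag m f * transpose_mat V" by blast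
  \<comment> \<open>The eigenvalue split off takes index 0, hence the shift of \<open>f\<close> by
    one.\<close>
  define g where "g = (\<lambda>i. if i = 0 then a else f (i - 1))"
  let ?a = "mat 1 1 (\<lambda>_. a)"
  let ?B = "\<lambda>A X. four_block_mat A (0\<^sub>m 1 m) (0\<^sub>m m 1) X"
  define W where "W = ?B (1\<^sub>m 1) V"
  have W: "W \<in> carrier_mat ?n ?n"
    using four_block_carrier_mat[of "1\<^sub>m 1" 1 1 V m m] V(1) by (simp add: W_def)
  have WT: "transpose_mat W = ?B (1\<^sub>m 1) (transpose_mat V)"
    unfolding W_def using V(1) by (subst transpose_four_block_mat[of _ 1 1 _ m _ m]) auto
  have BB: "?B A X * ?B A' X' = ?B (A * A') (X * X')"
    if "A \<in> carrier_mat 1 1" "A' \<in> carrier_mat 1 1" "X \<in> carrier_mat m m" "X' \<in> carrier_mat m m"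
    for A A' X X' :: "real mat"
    using that by (subst mult_four_block_mat[of _ 1 1 _ m _ m _ _ 1 _ m]) auto
  have D: "mat_diag ?n g = ?B ?a (mat_diag m f)"
    by (rule eq_matI) (auto simp: mat_diag_def g_def)
  have MB: "M = ?B ?a T"
    using M M0 M0' by (intro eq_matI) (auto simp: T_def)
  have WW: "transpose_mat W * W = 1\<^sub>m ?n"
    unfolding WT unfolding W_def using V by (subst BB) auto
  have MW: "M = W * mat_diag ?n g * transpose_mat W"
  proof -
    have "W * mat_diag ?n g = ?B (1\<^sub>m 1 * ?a) (V * mat_diag m f)"
      unfolding W_def D using V(1) by (intro BB) auto
    moreover have "?B (1\<^sub>m 1 * ?a) (V * mat_diag m f) * ?B (1\<^sub>m 1) (transpose_mat V)
        = ?B (1\<^sub>m 1 * ?a * 1\<^sub>m 1) (V * mat_diag m f * transpose_mat V)"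
      using V(1) by (intro BB) auto
    ultimately show ?thesis unfolding WT MB V(3) by simp
  qed
  let ?U = "H * W"
  have HU: "?U \<in> carrier_mat ?n ?n" using H W by simp
  note A = assoc_mult_mat[of _ ?n ?n _ ?n _ ?n]
  \<comment> \<open>\<open>H\<close> is a symmetric involution, hence orthogonal, and cancels
    between the two copies of \<open>W\<close>.\<close>
  have "transpose_mat ?U * ?U = transpose_mat W * (H * H) * W"
    using H(1,3) W by (simp add: transpose_mult[of _ ?n ?n _ ?n] A)
  also have "\<dots> = 1\<^sub>m ?n" using H(2) W WW by simp
  finally have UU: "transpose_mat ?U * ?U = 1\<^sub>m ?n" .
  have "S = (H * H) * S * (H * H)" using H(2) S(1) by simp
  also have "\<dots> = H * M * H" using H(1) S(1) by (simp add: M_def A)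
  also have "\<dots> = ?U * mat_diag ?n g * transpose_mat ?U"
    using H W by (simp add: MW transpose_mult[of _ ?n ?n _ ?n] A mult_carrier_mat[of _ ?n ?n _ ?n])
  finally show ?case using HU UU by blast
qed


section \<open>Functional calculus in a fixed orthonormal basis\<close>

text \<open>For orthogonal \<open>U\<close> the value \<open>f k\<close> is the eigenvalue along
  column \<open>k\<close> of \<open>U\<close>. Algebra on such matrices becomes pointwise algebra on
  \<open>f\<close>, so \<open>S\<close>, its resolvent and \<open>B_mat\<close> can all be treated
  as scalars.\<close>

definition conj_diag :: "nat \<Rightarrow> real mat \<Rightarrow> (nat \<Rightarrow> real) \<Rightarrow> real mat" where
  "conj_diag n U f = U * mat_diag n f * transpose_mat U"

locale orthogonal_mat =
  fixes n :: nat and U :: "real mat"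
  assumes carrier [simp]: "U \<in> carrier_mat n n"
    and transpose_mult_self: "transpose_mat U * U = 1\<^sub>m n"
begin

abbreviation cd :: "(nat \<Rightarrow> real) \<Rightarrow> real mat" where
  "cd \<equiv> conj_diag n U"

lemma mult_transpose_self: "U * transpose_mat U = 1\<^sub>m n"
  using mat_mult_left_right_inverse[of "transpose_mat U" n U] transpose_mult_self by simp

lemma conj_diag_carrier [simp]: "cd f \<in> carrier_mat n n"
  by (simp add: conj_diag_def mult_carrier_mat[of _ n n])

lemma conj_diag_dim [simp]: "dim_row (cd f) = n" "dim_col (cd f) = n"
  using conj_diag_carrier[of f] by (auto simp del: conj_diag_carrier)

lemma conj_diag_index:
  "i < n \<Longrightarrow> j < n \<Longrightarrow> cd f $$ (i, j) = (\<Sum>k = 0..<n. U $$ (i, k) * f k * U $$ (j, k))"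
  using carrier_matD[OF carrier]
  by (simp add: conj_diag_def mat_diag_mult_right[of _ n n] scalar_prod_def)

lemma conj_diag_cong: "(\<And>i. i < n \<Longrightarrow> f i = g i) \<Longrightarrow> cd f = cd g"
  by (rule eq_matI) (auto simp: conj_diag_index)

lemma conj_diag_add: "cd f + cd g = cd (\<lambda>i. f i + g i)"
  by (rule eq_matI) (auto simp: conj_diag_index algebra_simps sum.distrib)

lemma conj_diag_smult: "r \<cdot>\<^sub>m cd f = cd (\<lambda>i. r * f i)"
  by (rule eq_matI) (auto simp: conj_diag_index sum_distrib_left algebra_simps)

lemma conj_diag_one: "cd (\<lambda>_. 1) = 1\<^sub>m n"
  by (simp add: conj_diag_def mult_transpose_self right_mult_one_mat[of U n n])

lemma conj_diag_transpose: "transpose_mat (cd f) = cd f"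
  by (rule eq_matI) (auto simp: conj_diag_index algebra_simps)

lemma conj_diag_mult: "cd f * cd g = cd (\<lambda>i. f i * g i)"
proof -
  note A = assoc_mult_mat[of _ n n _ n _ n] mult_carrier_mat[of _ n n _ n]
  have "cd f * cd g = U * mat_diag n f * (transpose_mat U * U) * mat_diag n g * transpose_mat U"
    by (simp add: conj_diag_def A)
  also have "\<dots> = U * (mat_diag n f * mat_diag n g) * transpose_mat U"
    unfolding transpose_mult_self by (simp add: A left_mult_one_mat[of _ n n] del: mat_diag_diag)
  finally show ?thesis by (simp add: conj_diag_def)
qed

text \<open>After the two sums are exchanged, each \<open>f k\<close> is multiplied by the squared
  length of column \<open>k\<close> of \<open>U\<close>, which is 1.\<close>

lemma mat_tr_conj_diag: "mat_tr (cd f) = (\<Sum>k<n. f k)"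
proof -
  have "mat_tr (cd f) = (\<Sum>i = 0..<n. \<Sum>k = 0..<n. U $$ (i, k) * f k * U $$ (i, k))"
    by (simp add: mat_tr_def conj_diag_index lessThan_atLeast0)
  also have "\<dots> = (\<Sum>k = 0..<n. f k * (\<Sum>i = 0..<n. U $$ (i, k) * U $$ (i, k)))"
    by (subst sum.swap) (simp add: sum_distrib_left algebra_simps)
  also have "\<dots> = (\<Sum>k = 0..<n. f k)"
  proof (rule sum.cong)
    fix k assume k: "k \<in> {0..<n}"
    have "(\<Sum>i = 0..<n. U $$ (i, k) * U $$ (i, k)) = (transpose_mat U * U) $$ (k, k)"
      using k carrier by (simp add: scalar_prod_def del: carrier)
    then show "f k * (\<Sum>i = 0..<n. U $$ (i, k) * U $$ (i, k)) = f k"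
      unfolding transpose_mult_self using k by simp
  qed simp
  finally show ?thesis by (simp add: lessThan_atLeast0)
qed

text \<open>In the coordinates of \<open>v\<close> along the columns of \<open>U\<close> the form is
  diagonal.\<close>

lemma conj_diag_quadratic_form:
  assumes v: "v \<in> carrier_vec n"
  shows "v \<bullet> (cd f *\<^sub>v v) = (\<Sum>k<n. f k * ((transpose_mat U *\<^sub>v v) $ k)\<^sup>2)"
proof -
  define x where "x = transpose_mat U *\<^sub>v v"
  have x: "x \<in> carrier_vec n" using v by (simp add: x_def mult_mat_vec_carrier[of _ n n])
  have D: "mat_diag n f *\<^sub>v x = vec n (\<lambda>k. f k * x $ k)"
  proof (rule eq_vecI)
    fix k assume "k < dim_vec (vec n (\<lambda>k. f k * x $ k))"
    then have k: "k < n" by simp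
    have "(mat_diag n f *\<^sub>v x) $ k = (\<Sum>j = 0..<n. (if k = j then f j else 0) * x $ j)"
      using k x by (simp add: mat_diag_def scalar_prod_def)
    also have "\<dots> = (\<Sum>j = 0..<n. if k = j then f j * x $ j else 0)"
      by (rule sum.cong) auto
    finally show "(mat_diag n f *\<^sub>v x) $ k = vec n (\<lambda>k. f k * x $ k) $ k"
      using k by simp
  qed (simp add: mat_diag_def)
  have Dx: "mat_diag n f *\<^sub>v x \<in> carrier_vec n" by (simp add: D)
  have "v \<bullet> (cd f *\<^sub>v v) = v \<bullet> (U *\<^sub>v (mat_diag n f *\<^sub>v x))"
    using v by (simp add: conj_diag_def x_def assoc_mult_mat_vec[of _ n n _ n]
        mult_carrier_mat[of _ n n] mult_mat_vec_carrier[of _ n n])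
  also have "\<dots> = x \<bullet> (mat_diag n f *\<^sub>v x)"
    using transpose_vec_mult_scalar[OF carrier Dx v] by (simp add: x_def)
  also have "\<dots> = (\<Sum>k<n. f k * (x $ k)\<^sup>2)"
    unfolding D by (simp add: scalar_prod_def lessThan_atLeast0 power2_eq_square algebra_simps)
  finally show ?thesis by (simp add: x_def)
qed

text \<open>Parseval's identity, read off from the quadratic form of the identity matrix.\<close>

lemma sum_squares_transpose_mult:
  assumes v: "v \<in> carrier_vec n"
  shows "(\<Sum>k<n. ((transpose_mat U *\<^sub>v v) $ k)\<^sup>2) = v \<bullet> v"
  using conj_diag_quadratic_form[OF v, of "\<lambda>_. 1"] v by (simp add: conj_diag_one)

end

section \<open>The model quantities as sums over eigenvalues\<close>

locale psd_spectrum = orthogonal_mat d U for d :: nat and U :: "real mat" +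
  fixes S :: "real mat" and lam :: "nat \<Rightarrow> real"
  assumes S_eq: "S = conj_diag d U lam"
    and lam_nonneg: "\<And>i. i < d \<Longrightarrow> 0 \<le> lam i"

lemma psd_mat_spectrum:
  assumes "psd_mat d S"
  shows "\<exists>U lam. psd_spectrum d U S lam"
proof -
  obtain U lam where U: "U \<in> carrier_mat d d" "transpose_mat U * U = 1\<^sub>m d"
    "S = conj_diag d U lam"
    using assms real_spectral_theorem[of S d] by (auto simp: psd_mat_def conj_diag_def)
  interpret orthogonal_mat d U using U by unfold_locales
  have "0 \<le> lam i" if i: "i < d" for i
  proof -
    \<comment> \<open>This is column \<open>i\<close> of \<open>U\<close>; testing the form of
      \<open>S\<close> on it isolates \<open>lam i\<close>.\<close>
    define v where "v = U *\<^sub>v unit_vec d i"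
    have v: "v \<in> carrier_vec d" using U(1) by (simp add: v_def mult_mat_vec_carrier[of _ d d])
    have "transpose_mat U *\<^sub>v v = (transpose_mat U * U) *\<^sub>v unit_vec d i"
      by (simp add: v_def assoc_mult_mat_vec[of _ d d _ d])
    then have Uv: "transpose_mat U *\<^sub>v v = unit_vec d i"
      unfolding transpose_mult_self by simp
    have "0 \<le> v \<bullet> (S *\<^sub>v v)" using assms v by (simp add: psd_mat_def)
    also have "\<dots> = (\<Sum>k<d. if k = i then lam k else 0)"
      unfolding U(3) conj_diag_quadratic_form[OF v] Uv
      using i by (intro sum.cong) (auto simp: unit_vec_def)
    finally show ?thesis using i by simp
  qed
  then show ?thesis using U by (intro exI[of _ U] exI[of _ lam]) unfold_locales
qed

context psd_spectrum
begin

text \<open>The eigenvalues \<open>lam i + R\<close> are positive, so the candidate inverts the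
  matrix on both sides. Hence \<open>mat_inverse\<close> does not return \<open>None\<close>, and
  what it returns equals the candidate because a left and a right inverse agree.\<close>

lemma resolvent_eq:
  assumes "R > 0"
  shows "resolvent d S R = cd (\<lambda>i. 1 / (lam i + R))" (is "_ = ?G")
proof -
  define A where "A = S + R \<cdot>\<^sub>m 1\<^sub>m d"
  have A_eq: "A = cd (\<lambda>i. lam i + R)"
    by (simp add: A_def S_eq conj_diag_one[symmetric] conj_diag_smult conj_diag_add)
  have AC: "A \<in> carrier_mat d d" by (simp add: A_eq)
  have pos: "lam i + R > 0" if "i < d" for i using lam_nonneg[OF that] assms by simp
  have AG: "A * ?G = 1\<^sub>m d" "?G * A = 1\<^sub>m d"
    unfolding A_eq conj_diag_mult conj_diag_one[symmetric]
    using pos by (auto intro!: conj_diag_cong simp: less_imp_neq[symmetric])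
  have "A \<in> Units (ring_mat TYPE(real) d ())"
    using AC AG by (auto simp: Units_def ring_mat_def intro!: bexI[of _ ?G])
  then obtain B where B: "mat_inverse A = Some B"
    using mat_inverse(1)[OF AC, of "()"] by (cases "mat_inverse A") auto
  note B' = mat_inverse(2)[OF AC B]
  have "B = B * (A * ?G)" unfolding AG using B' by (simp add: right_mult_one_mat[of _ d d])
  also have "\<dots> = (B * A) * ?G"
    by (rule assoc_mult_mat[symmetric, of _ d d _ d _ d]) (use B' AC in auto)
  also have "\<dots> = ?G"
    unfolding conjunct1[OF conjunct2[OF B']] by (rule left_mult_one_mat[of _ d d]) simp
  finally show ?thesis by (simp add: resolvent_def A_def[symmetric] B)
qed

lemma m_S_eq:
  assumes "R > 0"
  shows "m_S d S R = (\<Sum>i<d. lam i / (lam i + R)) / d"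
  using assms by (simp add: m_S_def resolvent_eq) (simp add: S_eq conj_diag_mult mat_tr_conj_diag)

lemma B_mat_eq:
  assumes "R_sol d \<sigma> \<gamma> S \<alpha> > 0"
  shows "B_mat d \<sigma> \<gamma> S \<alpha> = cd (\<lambda>i. R_sol d \<sigma> \<gamma> S \<alpha> / (lam i + R_sol d \<sigma> \<gamma> S \<alpha>))"
  using assms by (simp add: B_mat_def resolvent_eq conj_diag_smult)

lemma mat_tr_B_mat_mult:
  assumes "R_sol d \<sigma> \<gamma> S \<alpha> = R" "R > 0"
  shows "mat_tr (B_mat d \<sigma> \<gamma> S \<alpha> * S) = (\<Sum>i<d. R * lam i / (lam i + R))"
  using assms by (simp add: B_mat_eq) (simp add: S_eq conj_diag_mult mat_tr_conj_diag)

text \<open>\<open>B\<close> is symmetric, so the form of \<open>S\<close> at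
  \<open>B *\<^sub>v w\<close> is the form of \<open>B * S * B\<close> at \<open>w\<close>, and all
  three factors are diagonal in the same basis.\<close>

lemma uSu_eq:
  assumes "R_sol d \<sigma> \<gamma> S \<alpha> = R" "R > 0" and w: "w \<in> carrier_vec d"
  shows "uSu d \<sigma> \<gamma> S w \<alpha> =
    (\<Sum>i<d. R\<^sup>2 * lam i / (lam i + R)\<^sup>2 * ((transpose_mat U *\<^sub>v w) $ i)\<^sup>2)"
proof -
  define B where "B = cd (\<lambda>i. R / (lam i + R))"
  have B: "B \<in> carrier_mat d d" "transpose_mat B = B"
    by (simp_all add: B_def conj_diag_transpose)
  have SC: "S \<in> carrier_mat d d" by (simp add: S_eq)
  have "uSu d \<sigma> \<gamma> S w \<alpha> = (transpose_mat B *\<^sub>v w) \<bullet> (S *\<^sub>v (B *\<^sub>v w))"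
    using assms by (simp add: uSu_def u_vec_def B_mat_eq B_def conj_diag_transpose)
  also have "\<dots> = w \<bullet> (B *\<^sub>v (S *\<^sub>v (B *\<^sub>v w)))"
    using B(1) SC w by (intro transpose_vec_mult_scalar) (auto simp: mult_mat_vec_carrier[of _ d d])
  also have "\<dots> = w \<bullet> ((B * S * B) *\<^sub>v w)"
    using B(1) SC w by (simp add: assoc_mult_mat_vec[of _ d d _ d] mult_mat_vec_carrier[of _ d d]
        mult_carrier_mat[of _ d d])
  also have "B * S * B = cd (\<lambda>i. R\<^sup>2 * lam i / (lam i + R)\<^sup>2)"
    by (simp add: B_def S_eq conj_diag_mult power2_eq_square mult.commute mult.left_commute)
  finally show ?thesis by (simp add: conj_diag_quadratic_form[OF w])
qed

end

section \<open>Scalar analysis of the self-consistent equation and of the quadratic form\<close>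

locale nonneg_spectrum =
  fixes d :: nat and lam :: "nat \<Rightarrow> real"
  assumes lam_nonneg: "\<And>i. i < d \<Longrightarrow> 0 \<le> lam i" and d_pos: "d \<ge> 1"
begin

text \<open>The normalised trace of \<open>B_R * S\<close> as a function of \<open>R\<close>, and so
  the quantity that the trace hypothesis controls.\<close>

definition g :: "real \<Rightarrow> real" where
  "g R = (\<Sum>i<d. R * lam i / (lam i + R)) / d"

definition g' :: "real \<Rightarrow> real" where
  "g' R = (\<Sum>i<d. (lam i)\<^sup>2 / (lam i + R)\<^sup>2) / d"

lemma lam_add_pos: "R > 0 \<Longrightarrow> i < d \<Longrightarrow> 0 < lam i + R"
  using lam_nonneg[of i] by simp

lemma g_nonneg: "R > 0 \<Longrightarrow> 0 \<le> g R"
  unfolding g_def using lam_nonneg lam_add_pos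
  by (intro divide_nonneg_nonneg sum_nonneg) (auto simp: less_imp_le)

lemma g_le:
  assumes "R > 0"
  shows "g R \<le> R"
proof -
  have "(\<Sum>i<d. R * lam i / (lam i + R)) \<le> (\<Sum>i<d. R)"
    using lam_nonneg lam_add_pos[OF assms] assms
    by (intro sum_mono) (auto simp: divide_le_eq algebra_simps)
  then show ?thesis using d_pos by (simp add: g_def divide_le_eq algebra_simps)
qed

text \<open>Termwise, the left side carries one more factor \<open>lam i / (lam i + R)\<close>,
  which is at most 1. This keeps \<open>c + g R - R * g' R\<close> at least \<open>c\<close>, which
  yields both the monotonicity of \<open>ratio\<close> and the bound on the derivative of its
  inverse.\<close>

lemma mult_g'_le:
  assumes "R > 0"
  shows "R * g' R \<le> g R"
proof -
  have "R * ((lam i)\<^sup>2 / (lam i + R)\<^sup>2) \<le> R * lam i / (lam i + R)" if "i < d" for i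
  proof -
    have "lam i / (lam i + R) \<le> 1" using lam_add_pos[OF assms that] assms by simp
    then have "R * lam i / (lam i + R) * (lam i / (lam i + R)) \<le> R * lam i / (lam i + R) * 1"
      using lam_nonneg[OF that] lam_add_pos[OF assms that] assms
      by (intro mult_left_mono) auto
    then show ?thesis by (simp add: power2_eq_square)
  qed
  then show ?thesis
    by (auto simp: g_def g'_def sum_distrib_left intro!: divide_right_mono sum_mono)
qed

lemma DERIV_g:
  assumes "R > 0"
  shows "(g has_real_derivative g' R) (at R)"
proof -
  have "((\<lambda>R. R * lam i / (lam i + R)) has_real_derivative (lam i)\<^sup>2 / (lam i + R)\<^sup>2) (at R)"
    if "i < d" for i
    using lam_add_pos[OF assms that]
    by (auto intro!: derivative_eq_intros simp: power2_eq_square field_simps)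
  then show ?thesis unfolding g_def g'_def
    by (intro DERIV_cdivide DERIV_sum) auto
qed

text \<open>The value of \<open>\<alpha>\<close> for which \<open>R\<close> solves the self-consistent equation with \<open>c = \<sigma>\<^sup>2 / \<gamma>\<^sup>2\<close>.\<close>

definition ratio :: "real \<Rightarrow> real \<Rightarrow> real" where
  "ratio c R = R / (c + g R)"

lemma ratio_denominator_pos: "c > 0 \<Longrightarrow> R > 0 \<Longrightarrow> 0 < c + g R"
  using g_nonneg[of R] by simp

lemma DERIV_ratio:
  assumes "c > 0" "R > 0"
  shows "(ratio c has_real_derivative (c + g R - R * g' R) / (c + g R)\<^sup>2) (at R)"
  unfolding ratio_def using ratio_denominator_pos[OF assms]
  by (auto intro!: derivative_eq_intros DERIV_g assms simp: power2_eq_square)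

lemma ratio_strict_mono:
  assumes "c > 0" "0 < x" "x < y"
  shows "ratio c x < ratio c y"
proof (rule DERIV_pos_imp_increasing[OF assms(3)])
  fix z assume z: "x \<le> z" "z \<le> y"
  then have "0 < z" using assms by simp
  moreover have "(c + g z - z * g' z) / (c + g z)\<^sup>2 > 0"
    using mult_g'_le[of z] ratio_denominator_pos[of c z] assms \<open>0 < z\<close> by simp
  ultimately show "\<exists>D. (ratio c has_real_derivative D) (at z) \<and> 0 < D"
    using DERIV_ratio[OF assms(1)] by blast
qed

lemma ratio_inj:
  assumes "c > 0" "x > 0" "y > 0" "ratio c x = ratio c y"
  shows "x = y"
  using ratio_strict_mono[of c x y] ratio_strict_mono[of c y x] assms
  by (cases x y rule: linorder_cases) auto

text \<open>From \<open>0 \<le> g R\<close> and \<open>g R \<le> R\<close>, the ratio lies between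
  \<open>R / (c + R)\<close> and \<open>R / c\<close>. Equating these bounds with \<alpha> gives the
  endpoints \<open>b\<close> and \<open>a\<close> for the intermediate value theorem;
  \<open>b\<close> is positive because \<alpha> is below 1.\<close>

lemma ratio_surj:
  assumes c: "c > 0" and \<alpha>: "0 < \<alpha>" "\<alpha> < 1"
  shows "\<exists>R>0. ratio c R = \<alpha>"
proof -
  define a where "a = c * \<alpha>"
  define b where "b = c * \<alpha> / (1 - \<alpha>)"
  have a: "a > 0" and ab: "a \<le> b" using c \<alpha> by (auto simp: a_def b_def field_simps)
  have lo: "ratio c a \<le> \<alpha>"
    using g_nonneg[OF a] ratio_denominator_pos[OF c a] \<alpha> c
    by (simp add: ratio_def divide_le_eq a_def algebra_simps)
  have b: "b > 0" using a ab by simp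
  have "\<alpha> * (c + g b) \<le> \<alpha> * (c + b)" using g_le[OF b] \<alpha> by simp
  also have "\<dots> = b" using \<alpha> by (simp add: b_def field_simps)
  finally have hi: "\<alpha> \<le> ratio c b"
    using ratio_denominator_pos[OF c b] by (simp add: ratio_def le_divide_eq)
  have "continuous_on {a..b} (ratio c)"
  proof (intro continuous_at_imp_continuous_on ballI)
    fix x assume "x \<in> {a..b}"
    then show "isCont (ratio c) x" using a DERIV_isCont[OF DERIV_ratio[OF c, of x]] by simp
  qed
  from IVT'[OF lo hi ab this] show ?thesis using a less_le_trans by blast
qed

text \<open>Inverse function rule. The left inverse \<open>r\<close> stands for
  \<open>R_sol\<close>; that it is also a right inverse on the interval (0, 1) follows from
  surjectivity of \<open>ratio c\<close>.\<close>

lemma DERIV_ratio_inverse: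
  assumes c: "c > 0" and \<alpha>: "0 < \<alpha>" "\<alpha> < 1" and R: "R > 0" "ratio c R = \<alpha>"
    and inv: "\<And>z. z > 0 \<Longrightarrow> r (ratio c z) = z"
  shows "(r has_real_derivative (c + g R)\<^sup>2 / (c + g R - R * g' R)) (at \<alpha>)"
proof -
  have rR: "r \<alpha> = R" using inv[OF R(1)] R(2) by simp
  have pos: "(c + g R - R * g' R) / (c + g R)\<^sup>2 > 0"
    using mult_g'_le[OF R(1)] ratio_denominator_pos[OF c R(1)] c by simp
  have "isCont r (ratio c R)"
  \<comment> \<open>The interval from \<open>R / 2\<close> to \<open>2 * R\<close> serves only as a
    neighbourhood of \<open>R\<close> inside the positive reals.\<close>
  proof (rule isCont_inverse_function2[where f = "ratio c" and x = R and a = "R / 2" and b = "2 * R"])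
    show "R / 2 < R" "R < 2 * R" using R by auto
    fix z assume "R / 2 \<le> z" "z \<le> 2 * R"
    then have "z > 0" using R by simp
    then show "r (ratio c z) = z" "isCont (ratio c) z"
      using inv DERIV_ratio[OF c] DERIV_isCont by blast+
  qed
  moreover have "ratio c (r a) = a" if "0 < a" "a < 1" for a
    using ratio_surj[OF c that] inv by auto
  ultimately have "(r has_real_derivative inverse ((c + g R - R * g' R) / (c + g R)\<^sup>2)) (at \<alpha>)"
    using DERIV_ratio[OF c R(1)] pos \<alpha> R(2)
    by (intro DERIV_inverse_function[where f = "ratio c" and a = 0 and b = 1]) (auto simp: rR)
  then show ?thesis by simp
qed

text \<open>The left side is \<alpha> times the derivative of \<open>R\<close> in \<alpha>. It
  simplifies to \<open>R * (c + g R)\<close> over a denominator that is at least \<open>c\<close>,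
  and \<open>small\<close> bounds \<open>c + g R\<close> by \<open>(1 + \<eta>) * c\<close>.\<close>

lemma mult_inverse_derivative_le:
  assumes c: "c > 0" and R: "R > 0" and small: "g R \<le> \<eta> * c"
  shows "ratio c R * ((c + g R)\<^sup>2 / (c + g R - R * g' R)) \<le> R * (1 + \<eta>)"
proof -
  have pos: "c + g R > 0" using ratio_denominator_pos[OF c R] .
  have le: "c \<le> c + g R - R * g' R" using mult_g'_le[OF R] by simp
  have "ratio c R * ((c + g R)\<^sup>2 / (c + g R - R * g' R)) = R * (c + g R) / (c + g R - R * g' R)"
    using pos by (simp add: ratio_def power2_eq_square)
  also have "\<dots> \<le> R * (c + g R) / c"
    using le c R pos by (intro divide_left_mono) auto
  also have "\<dots> \<le> R * (1 + \<eta>)"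
    using small c R by (simp add: divide_le_eq mult.assoc algebra_simps)
  finally show ?thesis .
qed

text \<open>\<open>u\<^sup>T S u\<close> as a function of \<open>R\<close>, where \<open>y i\<close> is the squared coordinate of \<open>w\<close> along the \<open>i\<close>-th eigenvector.\<close>

definition Q :: "(nat \<Rightarrow> real) \<Rightarrow> real \<Rightarrow> real" where
  "Q y R = (\<Sum>i<d. R\<^sup>2 * lam i / (lam i + R)\<^sup>2 * y i)"

definition Q' :: "(nat \<Rightarrow> real) \<Rightarrow> real \<Rightarrow> real" where
  "Q' y R = (\<Sum>i<d. 2 * R * (lam i)\<^sup>2 / (lam i + R) ^ 3 * y i)"

lemma DERIV_Q:
  assumes "R > 0"
  shows "(Q y has_real_derivative Q' y R) (at R)"
proof -
  have "((\<lambda>R. R\<^sup>2 * lam i / (lam i + R)\<^sup>2 * y i)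
      has_real_derivative 2 * R * (lam i)\<^sup>2 / (lam i + R) ^ 3 * y i) (at R)" if "i < d" for i
  proof (rule DERIV_cmult_right)
    have p: "lam i + R \<noteq> 0" using lam_add_pos[OF assms that] by simp
    have "((\<lambda>R. R\<^sup>2 * lam i / (lam i + R)\<^sup>2) has_real_derivative
        ((2 * R) * lam i * (lam i + R)\<^sup>2 - R\<^sup>2 * lam i * (2 * (lam i + R))) / ((lam i + R)\<^sup>2 * (lam i + R)\<^sup>2)) (at R)"
      using p by (auto intro!: derivative_eq_intros simp: power2_eq_square)
    \<comment> \<open>One factor \<open>lam i + R\<close> comes out of the numerator, which lowers
      the denominator from fourth to third power.\<close>
    also have "(2 * R) * lam i * (lam i + R)\<^sup>2 - R\<^sup>2 * lam i * (2 * (lam i + R))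
        = (lam i + R) * (2 * R * (lam i)\<^sup>2)"
      by (simp add: power2_eq_square algebra_simps)
    also have "\<dots> / ((lam i + R)\<^sup>2 * (lam i + R)\<^sup>2) = 2 * R * (lam i)\<^sup>2 / (lam i + R) ^ 3"
      using p by (simp add: power2_eq_square power3_eq_cube mult.assoc)
    finally show "((\<lambda>R. R\<^sup>2 * lam i / (lam i + R)\<^sup>2) has_real_derivative
        2 * R * (lam i)\<^sup>2 / (lam i + R) ^ 3) (at R)" .
  qed
  then show ?thesis unfolding Q_def Q'_def by (intro DERIV_sum) auto
qed

lemma Q_le:
  assumes "R > 0" and y: "\<And>i. i < d \<Longrightarrow> 0 \<le> y i"
  shows "Q y R \<le> R / 4 * (\<Sum>i<d. y i)"
  unfolding Q_def sum_distrib_left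
proof (rule sum_mono)
  fix i assume "i \<in> {..<d}"
  then have i: "i < d" by simp
  \<comment> \<open>AM-GM: \<open>4 * R * lam i \<le> (lam i + R)\<^sup>2\<close>\<close>
  have "4 * (R\<^sup>2 * lam i) \<le> R * (lam i + R)\<^sup>2"
    using mult_left_mono[OF zero_le_power2[of "lam i - R"], of R] assms
    by (simp add: power2_eq_square algebra_simps)
  then have "R\<^sup>2 * lam i / (lam i + R)\<^sup>2 \<le> R / 4"
    using lam_add_pos[OF assms(1) i] by (simp add: divide_le_eq)
  then show "R\<^sup>2 * lam i / (lam i + R)\<^sup>2 * y i \<le> R / 4 * y i"
    using y[OF i] by (rule mult_right_mono)
qed

text \<open>Both \<open>R\<close> and \<open>lam i\<close> are at most \<open>lam i + R\<close>, so
  each coefficient is at most 2. This bound involves neither \<open>R\<close> nor the spectrum; the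
  smallness of the final estimate has to come from \<alpha> times the derivative of
  \<open>R\<close>.\<close>

lemma Q'_bounds:
  assumes "R > 0" and y: "\<And>i. i < d \<Longrightarrow> 0 \<le> y i"
  shows "0 \<le> Q' y R" "Q' y R \<le> 2 * (\<Sum>i<d. y i)"
proof -
  show "0 \<le> Q' y R"
    unfolding Q'_def using assms(1) y lam_add_pos[OF assms(1)]
    by (intro sum_nonneg mult_nonneg_nonneg divide_nonneg_nonneg) (auto simp: less_imp_le)
  show "Q' y R \<le> 2 * (\<Sum>i<d. y i)"
    unfolding Q'_def sum_distrib_left
  proof (rule sum_mono)
    fix i assume "i \<in> {..<d}"
    then have i: "i < d" by simp
    have l: "0 \<le> lam i" by (rule lam_nonneg[OF i])
    have "R * (lam i)\<^sup>2 \<le> (lam i + R) * (lam i + R)\<^sup>2"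
      using l assms(1) by (intro mult_mono power_mono) auto
    then have "2 * R * (lam i)\<^sup>2 / (lam i + R) ^ 3 \<le> 2"
      using lam_add_pos[OF assms(1) i]
      by (simp add: divide_le_eq power3_eq_cube power2_eq_square mult.assoc)
    then show "2 * R * (lam i)\<^sup>2 / (lam i + R) ^ 3 * y i \<le> 2 * y i"
      using y[OF i] by (rule mult_right_mono)
  qed
qed

end

section \<open>Logarithmic derivatives of the error formula\<close>

lemma has_dlog_dlog_inverse_square:
  assumes "A > 0" "C > 0"
  shows "has_dlog_dlog (\<lambda>k. A / k\<^sup>2 * C) (- 2) x"
proof -
  have "ln (A / (exp t)\<^sup>2 * C) = ln (A * C) - 2 * t" for t :: real
    using assms by (simp add: ln_mult ln_div ln_realpow)
  then show ?thesis unfolding has_dlog_dlog_def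
    by (auto intro!: derivative_eq_intros)
qed

text \<open>Applied with \<open>q\<close> the form \<open>uSu\<close>, \<open>a = d\<close> and
  \<open>b = \<sigma>\<^sup>2 * d\<close>; \<open>K\<close> collects the factors free of
  \<open>n\<close>. The chain rule runs through \<open>a / exp t\<close>, whose derivative at
  \<open>ln x\<close> is \<open>- (a / x)\<close>.\<close>

lemma has_dlog_dlog_inverse_sqrt:
  assumes q: "(q has_real_derivative q') (at (a / x))"
    and x: "x > 0" and K: "K > 0" and b: "b > 0" and pos: "0 < b - 2 * q (a / x)"
  shows "has_dlog_dlog (\<lambda>x. K * (1 / sqrt (1 - 2 / b * q (a / x))))
    (- (a / x * q' / (b - 2 * q (a / x)))) x"
proof -
  define X where "X = (\<lambda>t. 1 - 2 / b * q (a / exp t))"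
  have Xpos: "X (ln x) > 0" using pos b x by (simp add: X_def field_simps)
  have dX: "(X has_real_derivative 2 / b * q' * (a / x)) (at (ln x))"
  proof -
    have *: "((\<lambda>t. a / exp t) has_real_derivative - (a / x)) (at (ln x))"
      using x by (auto intro!: derivative_eq_intros)
    have "((\<lambda>t. q (a / exp t)) has_real_derivative q' * - (a / x)) (at (ln x))"
      using DERIV_chain2[OF _ *] q x by simp
    from DERIV_diff[OF DERIV_const[of 1] DERIV_cmult[OF this, of "2 / b"]] show ?thesis
      by (simp add: X_def mult.assoc)
  qed
  have cont: "isCont X (ln x)" using dX DERIV_isCont by blast
  \<comment> \<open>The logarithm splits where \<open>X\<close> is positive. Continuity gives this
    near \<open>ln x\<close>, which is enough for a derivative there.\<close>
  then have ev: "eventually (\<lambda>t. X t > 0) (nhds (ln x))"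
    using Xpos order_tendstoD(1)[of X "X (ln x)" "nhds (ln x)" 0]
    by (simp add: isCont_def tendsto_at_iff_tendsto_nhds)
  have "((\<lambda>t. ln K - ln (X t) / 2) has_real_derivative - (a / x * q' / (b - 2 * q (a / x)))) (at (ln x))"
  proof -
    have "X (ln x) = (b - 2 * q (a / x)) / b" using b x by (simp add: X_def field_simps)
    then have "- (a / x * q' / (b - 2 * q (a / x))) = - (2 / b * q' * (a / x) / X (ln x)) / 2"
      using b pos by simp
    then show ?thesis using Xpos by (auto intro!: derivative_eq_intros dX)
  qed
  moreover have "eventually (\<lambda>t. ln (K * (1 / sqrt (X t))) = ln K - ln (X t) / 2) (nhds (ln x))"
    using ev by eventually_elim (use K in \<open>simp add: ln_div ln_sqrt\<close>)
  ultimately have "((\<lambda>t. ln (K * (1 / sqrt (X t)))) has_real_derivative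
      - (a / x * q' / (b - 2 * q (a / x)))) (at (ln x))"
    by (subst DERIV_cong_ev[OF refl _ refl]) auto
  then show ?thesis by (simp add: has_dlog_dlog_def X_def)
qed

lemma dlog_dlog_eqI: "has_dlog_dlog f D x \<Longrightarrow> dlog_dlog f x = D"
  by (simp add: has_dlog_dlog_def dlog_dlog_def DERIV_imp_deriv)

section \<open>Transfer to the matrix model and the final estimate\<close>

lemma (in psd_spectrum) nonneg_spectrum: "d \<ge> 1 \<Longrightarrow> nonneg_spectrum d lam"
  using lam_nonneg by unfold_locales

text \<open>For positive \<open>R\<close> the self-consistent equation rearranges to
  \<open>ratio c R = \<alpha>\<close>, and injectivity of \<open>ratio\<close> makes the definite
  description in \<open>R_sol\<close> well defined.\<close>

lemma (in psd_spectrum) R_sol_ratio: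
  assumes "d \<ge> 1" "\<sigma> > 0" "\<gamma> > 0" "z > 0"
  shows "R_sol d \<sigma> \<gamma> S (nonneg_spectrum.ratio d lam (\<sigma>\<^sup>2 / \<gamma>\<^sup>2) z) = z"
proof -
  interpret N: nonneg_spectrum d lam using nonneg_spectrum assms(1) .
  let ?c = "\<sigma>\<^sup>2 / \<gamma>\<^sup>2"
  have c: "?c > 0" using assms by simp
  have "R * (1 - \<alpha> * m_S d S R) = ?c * \<alpha> \<longleftrightarrow> N.ratio ?c R = \<alpha>" if R: "R > 0" for R \<alpha>
  proof -
    have "R * m_S d S R = N.g R"
      using R by (simp add: m_S_eq N.g_def sum_distrib_left)
    then have "R * (1 - \<alpha> * m_S d S R) = R - \<alpha> * N.g R"
      by (simp add: algebra_simps)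
    then show ?thesis
      using N.ratio_denominator_pos[OF c R] by (auto simp: N.ratio_def divide_eq_eq algebra_simps)
  qed
  then show ?thesis unfolding R_sol_def
    using assms N.ratio_inj[OF c] by (intro the_equality) auto
qed

theorem mainTheorem7:
  fixes \<epsilon> :: real
  assumes "\<epsilon> > 0"
  shows "\<exists>\<eta>>0. \<forall>(d::nat) (\<sigma>::real) (\<gamma>::real) (S::real mat) (w::real vec) (n::real) (k::real) (\<alpha>::real).
    d \<ge> 1 \<longrightarrow> \<sigma> > 0 \<longrightarrow> \<gamma> > 0 \<longrightarrow> psd_mat d S \<longrightarrow>
    w \<in> carrier_vec d \<longrightarrow> w \<bullet> w = real d \<longrightarrow>
    n > real d \<longrightarrow> k > 0 \<longrightarrow> \<alpha> = real d / n \<longrightarrow>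
    \<gamma>\<^sup>2 / (real d * \<sigma>\<^sup>2) * mat_tr (B_mat d \<sigma> \<gamma> S \<alpha> * S) < \<eta> \<longrightarrow>
    R_sol d \<sigma> \<gamma> S \<alpha> / \<sigma>\<^sup>2 < \<eta> \<longrightarrow>
      has_dlog_dlog (\<lambda>k'. gen_error d \<sigma> \<gamma> S w k' n) (- 2) k \<and>
      uSu d \<sigma> \<gamma> S w differentiable (at \<alpha>) \<and>
      has_dlog_dlog (\<lambda>n'. gen_error d \<sigma> \<gamma> S w k n')
        (- (\<alpha> * deriv (uSu d \<sigma> \<gamma> S w) \<alpha> /
            (\<sigma>\<^sup>2 * real d - 2 * uSu d \<sigma> \<gamma> S w \<alpha>))) n \<and>
      \<bar>dlog_dlog (\<lambda>n'. gen_error d \<sigma> \<gamma> S w k n') n\<bar>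
        \<le> \<epsilon> * \<bar>dlog_dlog (\<lambda>k'. gen_error d \<sigma> \<gamma> S w k' n) k\<bar>"
proof (intro exI[of _ "min (1 / 2) (\<epsilon> / 2)"] conjI allI impI)
  \<comment> \<open>The bound 1/2 keeps the denominator at least
    \<open>3 / 4 * (\<sigma>\<^sup>2 * d)\<close> and \<open>1 + \<eta>\<close> at most 3/2. The
    derivative in \<open>n\<close> then comes out at most \<open>4 * \<eta>\<close>, to be compared
    with \<open>2 * \<epsilon>\<close>; hence \<open>\<epsilon> / 2\<close>.\<close>
  define \<eta> where "\<eta> = min (1 / 2) (\<epsilon> / 2)"
  show "0 < min (1 / 2) (\<epsilon> / 2)" using assms by simp
  fix d :: nat and \<sigma> \<gamma> :: real and S :: "real mat" and w :: "real vec" and n k \<alpha> :: real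
  assume d: "d \<ge> 1" and \<sigma>: "\<sigma> > 0" and \<gamma>: "\<gamma> > 0" and S: "psd_mat d S"
    and w: "w \<in> carrier_vec d" "w \<bullet> w = real d" and n: "n > real d" and k: "k > 0"
    and \<alpha>_eq: "\<alpha> = real d / n"
    and tr_small: "\<gamma>\<^sup>2 / (real d * \<sigma>\<^sup>2) * mat_tr (B_mat d \<sigma> \<gamma> S \<alpha> * S) < min (1 / 2) (\<epsilon> / 2)"
    and R_small: "R_sol d \<sigma> \<gamma> S \<alpha> / \<sigma>\<^sup>2 < min (1 / 2) (\<epsilon> / 2)"
  obtain U lam where "psd_spectrum d U S lam" using psd_mat_spectrum[OF S] by blast
  then interpret psd_spectrum d U S lam .
  interpret N: nonneg_spectrum d lam using nonneg_spectrum d .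
  define c where "c = \<sigma>\<^sup>2 / \<gamma>\<^sup>2"
  have c: "c > 0" using \<sigma> \<gamma> by (simp add: c_def)
  have \<alpha>: "0 < \<alpha>" "\<alpha> < 1" using d n by (auto simp: \<alpha>_eq)
  note inv = R_sol_ratio[OF d \<sigma> \<gamma>, folded c_def]
  have R_sol_pos: "0 < R_sol d \<sigma> \<gamma> S a" if "a \<in> {0<..<1}" for a
    using that N.ratio_surj[OF c, of a] inv by auto
  define R where "R = R_sol d \<sigma> \<gamma> S \<alpha>"
  have R: "R > 0" "N.ratio c R = \<alpha>"
    using N.ratio_surj[OF c \<alpha>] inv by (auto simp: R_def)
  define y where "y = (\<lambda>i. ((transpose_mat U *\<^sub>v w) $ i)\<^sup>2)"
  have y: "\<And>i. 0 \<le> y i" "(\<Sum>i<d. y i) = d"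
    using sum_squares_transpose_mult[OF w(1)] w(2) by (auto simp: y_def)
  let ?q = "uSu d \<sigma> \<gamma> S w"
  \<comment> \<open>An identity at \<alpha> alone could not be differentiated; it is proved on the
    open interval (0, 1) around \<alpha>.\<close>
  have q_eq: "?q a = N.Q y (R_sol d \<sigma> \<gamma> S a)" if "a \<in> {0<..<1}" for a
    using uSu_eq[OF refl R_sol_pos[OF that] w(1)] by (simp add: N.Q_def y_def)
  define r' where "r' = (c + N.g R)\<^sup>2 / (c + N.g R - R * N.g' R)"
  have "(R_sol d \<sigma> \<gamma> S has_real_derivative r') (at \<alpha>)"
    unfolding r'_def using N.DERIV_ratio_inverse[OF c \<alpha> R inv] by blast
  then have "((\<lambda>a. N.Q y (R_sol d \<sigma> \<gamma> S a)) has_real_derivative N.Q' y R * r') (at \<alpha>)"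
    using N.DERIV_Q[OF R(1)] by (intro DERIV_chain2[of "N.Q y"]) (simp_all add: R_def)
  then have dq: "(?q has_real_derivative N.Q' y R * r') (at \<alpha>)"
    by (rule has_field_derivative_transform_within_open[of _ _ _ "{0<..<1}"])
      (use \<alpha> q_eq in auto)
  have q': "deriv ?q \<alpha> = N.Q' y R * r'" by (rule DERIV_imp_deriv[OF dq])
  have Q_le: "?q \<alpha> \<le> R / 4 * d"
    using N.Q_le[OF R(1), of y] y q_eq[of \<alpha>] \<alpha> by (simp add: R_def)
  have R_le: "R \<le> \<eta> * \<sigma>\<^sup>2"
    using R_small \<sigma> by (simp add: R_def[symmetric] \<eta>_def[symmetric] divide_less_eq)
  have \<eta>: "0 < \<eta>" "\<eta> \<le> 1 / 2" "\<eta> \<le> \<epsilon> / 2" using assms by (auto simp: \<eta>_def)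
  have d': "real d > 0" using d by simp
  have "R * d \<le> 1 / 2 * \<sigma>\<^sup>2 * d"
    using R_le \<eta> mult_right_mono[OF \<eta>(2), of "\<sigma>\<^sup>2"] by (intro mult_right_mono) auto
  \<comment> \<open>\<open>Q_le\<close> bounds twice the form by \<open>R * d / 2\<close>, which is
    at most a quarter of \<open>\<sigma>\<^sup>2 * d\<close>.\<close>
  then have den: "3 / 4 * (\<sigma>\<^sup>2 * d) \<le> \<sigma>\<^sup>2 * d - 2 * ?q \<alpha>"
    using Q_le by (simp add: algebra_simps)
  have den_pos: "0 < \<sigma>\<^sup>2 * d - 2 * ?q \<alpha>"
    by (rule less_le_trans[OF _ den]) (use d' \<sigma> in simp)
  let ?D = "- (\<alpha> * deriv ?q \<alpha> / (\<sigma>\<^sup>2 * real d - 2 * ?q \<alpha>))"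
  have root_pos: "0 < 1 - 2 / (\<sigma>\<^sup>2 * real d) * ?q \<alpha>"
    using den_pos \<sigma> d' by (simp add: field_simps)
  show dk: "has_dlog_dlog (\<lambda>k'. gen_error d \<sigma> \<gamma> S w k' n) (- 2) k"
    unfolding gen_error_def using root_pos \<sigma>
    by (intro has_dlog_dlog_inverse_square) (auto simp: \<alpha>_eq)
  show "?q differentiable (at \<alpha>)"
    using dq real_differentiable_def by blast
  show dn: "has_dlog_dlog (\<lambda>n'. gen_error d \<sigma> \<gamma> S w k n') ?D n"
    unfolding gen_error_def q' unfolding \<alpha>_eq
    by (rule has_dlog_dlog_inverse_sqrt)
      (use dq den_pos \<sigma> d' k n in \<open>auto simp: \<alpha>_eq\<close>)
  \<comment> \<open>With \<open>c = \<sigma>\<^sup>2 / \<gamma>\<^sup>2\<close>, the trace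
    hypothesis is exactly \<open>g R / c < \<eta>\<close>.\<close>
  have "N.g R < \<eta> * c"
  proof -
    have "N.g R = mat_tr (B_mat d \<sigma> \<gamma> S \<alpha> * S) / d"
      using mat_tr_B_mat_mult[OF R_def[symmetric] R(1)] by (simp add: N.g_def)
    then have "N.g R / c < \<eta>"
      using tr_small by (simp add: c_def \<eta>_def field_simps)
    then show ?thesis using c by (simp add: divide_less_eq)
  qed
  then have "\<alpha> * r' \<le> R * (1 + \<eta>)"
    using N.mult_inverse_derivative_le[OF c R(1)] R(2) by (simp add: r'_def)
  also have "\<dots> \<le> R * (3 / 2)" using \<eta> R by simp
  finally have \<alpha>r: "\<alpha> * r' \<le> 3 / 2 * R" by simp
  have r'_nonneg: "0 \<le> r'"
    using N.mult_g'_le[OF R(1)] c by (simp add: r'_def)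
  note Q' = N.Q'_bounds[OF R(1), of y, unfolded y(2), OF y(1)]
  \<comment> \<open>The first factor is only bounded, by \<open>2 * d\<close>; the second is of
    order \<open>R\<close>, hence small against \<open>\<sigma>\<^sup>2\<close>. The constant 3 then
    meets the 3/4 of \<open>den\<close> to give 4.\<close>
  have "\<alpha> * deriv ?q \<alpha> = N.Q' y R * (\<alpha> * r')" by (simp add: q')
  also have "\<dots> \<le> (2 * real d) * (3 / 2 * R)"
    by (rule mult_mono[OF Q'(2) \<alpha>r]) (use \<alpha> r'_nonneg in auto)
  also have "\<dots> \<le> 3 * real d * (\<eta> * \<sigma>\<^sup>2)"
    using mult_left_mono[OF R_le, of "3 * real d"] by (simp add: algebra_simps)
  also have "\<dots> \<le> 4 * \<eta> * (\<sigma>\<^sup>2 * d - 2 * ?q \<alpha>)"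
    using mult_left_mono[OF den, of "4 * \<eta>"] \<eta> by (simp add: algebra_simps)
  finally have "\<alpha> * deriv ?q \<alpha> / (\<sigma>\<^sup>2 * d - 2 * ?q \<alpha>) \<le> 4 * \<eta>"
    using den_pos by (simp add: divide_le_eq)
  moreover have "0 \<le> \<alpha> * deriv ?q \<alpha> / (\<sigma>\<^sup>2 * d - 2 * ?q \<alpha>)"
    using den_pos \<alpha> Q' r'_nonneg by (simp add: q')
  ultimately have "\<bar>?D\<bar> \<le> \<epsilon> * \<bar>- 2\<bar>" using \<eta> by linarith
  then show "\<bar>dlog_dlog (\<lambda>n'. gen_error d \<sigma> \<gamma> S w k n') n\<bar>
      \<le> \<epsilon> * \<bar>dlog_dlog (\<lambda>k'. gen_error d \<sigma> \<gamma> S w k' n) k\<bar>"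
    unfolding dlog_dlog_eqI[OF dk] dlog_dlog_eqI[OF dn] .
qed

end
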